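(* Let $G$ and $H$ be two finite simple graphs on a common vertex set $V$ of size $n$ such that $\deg_G(v)=\deg_H(v)$ for every $v\in V$. If the $2$-dimensional Weisfeiler--Leman algorithm cannot distinguish $G$ and $H$ (i.e. $G\cong_{2\text{-WL}}H$), then $G$ and $H$ share the generalized block Laplacian spectrum, i.e. $G\cong_{GBLS}H$.
   Context: Graphs are finite, simple, undirected; $A_G$ denotes the adjacency matrix. $2$-WL equivalence. For a matrix $A:V\times V\to C$ and $k\ge1$, the atomic type $\mathrm{tp}_A(i_1,\dots,i_k)$ of a $k$-tuple is the $k\times k$ array $T$ with $T_{p,q}=(0,A(i_p,i_q))$ if $i_p=i_q$ and $(1,A(i_p,i_q))$ if $i_p\neq i_q$. Set $X^1_{A,k}=\mathrm{tp}_A$ and $X^{r+1}_{A,k}(i_1\dots i_k)=\big(X^r_{A,k}(i_1\dots i_k),\ \{\!\{(\mathrm{tp}_A(i_1\dots i_k m),S^r_{A,k}(i_1\dots i_km)):m\in V\}\!\}\big)$, where $\{\!\{\cdot\}\!\}$ is a multiset and $S^r_{A,k}(i_1\dots i_km)$ is the sequence of colors $X^r_{A,k}$ of the tuples obtained from $(i_1,\dots,i_k)$ by replacing its $\ell$-th entry by $m$, for $\ell=k,\dots,1$. Let $M^r_{A,k}=\{\!\{X^r_{A,k}(x):x\in V^k\}\!\}$ and $I_{A,k}(t)=\sum_{r\ge1}t^rM^r_{A,k}$. Then $G\cong_{2\text{-WL}}H$ means $I_{A_G,2}(t)=I_{A_H,2}(t)$. Generalized block Laplacian spectrum. For $G,H$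 on $V$ with $\deg_G(v)=\deg_H(v)$ for all $v$, let $V=\bigsqcup_{i=1}^pV_i$ be the partition into degree classes, $e_i\in\{0,1\}^V$ the characteristic vector of $V_i$, and $J_{i,j}=e_ie_j^\top$. For a tuple $\mathbf A=(A_1,\dots,A_k)$ of $n\times n$ matrices and variables $\mathbf s=(s_1,\dots,s_k)$ put $W_{\mathbf A}(\mathbf s)=\sum_i s_iA_i$ and $\phi_{\mathbf A}(\mathbf s;t)=\det(tI-W_{\mathbf A}(\mathbf s))$. Then $G\cong_{GBLS}H$ means $\phi_{\mathbf A}(\mathbf s;t)=\phi_{\mathbf B}(\mathbf s;t)$ as polynomials, where $\mathbf A=(A_G,J_{1,1},J_{1,2},\dots,J_{p,p})$ and $\mathbf B=(A_H,J_{1,1},J_{1,2},\dots,J_{p,p})$ (all $p^2$ matrices $J_{i,j}$). *)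

theory Defs
  imports
    "HOL-Analysis.Determinants"
    "HOL-Library.Indicator_Function"
    "HOL-Library.Multiset"
    "HOL-Library.Poly_Mapping"
    "HOL-Computational_Algebra.Formal_Power_Series"
begin

text \<open>
  Graphs live on the finite type \<open>'v\<close> (the common vertex set). A graph is its set of
  ordered adjacent pairs, so an undirected edge occurs in both orientations.
\<close>

definition simple_graph :: "'v rel \<Rightarrow> bool" where
  "simple_graph G \<longleftrightarrow> sym G \<and> irrefl G"

definition vdeg :: "'v rel \<Rightarrow> 'v \<Rightarrow> nat" where
  "vdeg G v = card {w. (v, w) \<in> G}"

definition adj_matrix :: "'v::finite rel \<Rightarrow> real^'v^'v" where
  "adj_matrix G = (\<chi> v w. if (v, w) \<in> G then 1 else 0)"


section \<open>The Weisfeiler--Leman algorithm\<close>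

text \<open>Tuples of vertices are lists, and a \<open>k \<times> k\<close> array is the list of its rows.\<close>

type_synonym 'c atp = "(nat \<times> 'c) list list"

definition atomic_type :: "'c^'v^'v \<Rightarrow> 'v list \<Rightarrow> 'c atp" where
  "atomic_type A xs = map (\<lambda>x. map (\<lambda>y. (if x = y then 0 else 1, A $ x $ y)) xs) xs"

text \<open>
  The colors of successive rounds are nested ever deeper; the datatype accommodates all
  rounds. \<open>Refine\<close> is the pairing of an old color with a multiset.
\<close>

datatype 'c wl_color =
    Atomic "'c atp"
  | Refine "'c wl_color" "('c atp \<times> 'c wl_color list) multiset"

text \<open>
  Rounds are counted from 0 here: \<open>wl_coloring A r\<close> is the coloring \<open>X\<^sup>r\<^sup>+\<^sup>1\<close> for the matrix \<open>A\<close>.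
  The entries of the tuple are replaced in the order last to first.
\<close>

primrec wl_coloring :: "'c^'v::finite^'v \<Rightarrow> nat \<Rightarrow> 'v list \<Rightarrow> 'c wl_color" where
  "wl_coloring A 0 xs = Atomic (atomic_type A xs)"
| "wl_coloring A (Suc r) xs =
     Refine (wl_coloring A r xs)
       {#(atomic_type A (xs @ [m]),
          map (\<lambda>l. wl_coloring A r (xs[l := m])) (rev [0..<length xs])). m \<in># mset_set UNIV#}"

definition wl_multiset :: "'c^'v::finite^'v \<Rightarrow> nat \<Rightarrow> nat \<Rightarrow> 'c wl_color multiset" where
  "wl_multiset A k r = {#wl_coloring A r xs. xs \<in># mset_set {xs. length xs = k}#}"

text \<open>
  The invariant is the formal power series \<open>\<Sum>r\<ge>1. t\<^sup>r M\<^sup>r\<close> with multisets as coefficients.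
  The coefficient of \<open>t\<^sup>r\<^sup>+\<^sup>1\<close> is \<open>wl_multiset A k r\<close> because of the shift in counting rounds.
\<close>

definition wl_series :: "nat \<Rightarrow> 'c^'v::finite^'v \<Rightarrow> 'c wl_color multiset fps" where
  "wl_series k A = Abs_fps (\<lambda>n. case n of 0 \<Rightarrow> {#} | Suc r \<Rightarrow> wl_multiset A k r)"

definition wl_equiv :: "nat \<Rightarrow> 'v::finite rel \<Rightarrow> 'v rel \<Rightarrow> bool" where
  "wl_equiv k G H \<longleftrightarrow> wl_series k (adj_matrix G) = wl_series k (adj_matrix H)"


section \<open>The generalized block Laplacian spectrum\<close>

text \<open>
  Polynomials in variables indexed by natural numbers: finitely supported maps from
  monomials (finitely supported exponent vectors) to coefficients.
\<close>

type_synonym 'a mpoly = "(nat \<Rightarrow>\<^sub>0 nat) \<Rightarrow>\<^sub>0 'a"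

definition mvar :: "nat \<Rightarrow> 'a::comm_ring_1 mpoly" where
  "mvar i = Poly_Mapping.single (Poly_Mapping.single i 1) 1"

definition mconst :: "'a::comm_ring_1 \<Rightarrow> 'a mpoly" where
  "mconst c = Poly_Mapping.single 0 c"

text \<open>Variable 0 plays the role of \<open>t\<close>; the matrix at list position \<open>i\<close> gets variable \<open>i + 1\<close>.\<close>

definition lin_pencil :: "('a::comm_ring_1^'v^'v) list \<Rightarrow> 'a mpoly^'v^'v" where
  "lin_pencil As = (\<chi> v w. \<Sum>i<length As. mvar (Suc i) * mconst ((As ! i) $ v $ w))"

definition pencil_charpoly :: "('a::comm_ring_1^'v::finite^'v) list \<Rightarrow> 'a mpoly" where
  "pencil_charpoly As = det (mat (mvar 0) - lin_pencil As)"

text \<open>The nonempty degree classes, ordered by increasing degree.\<close>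

definition degree_classes :: "'v::finite rel \<Rightarrow> 'v set list" where
  "degree_classes G = map (\<lambda>d. {v. vdeg G v = d}) (sorted_list_of_set (range (vdeg G)))"

definition char_vec :: "'v::finite set \<Rightarrow> real^'v" where
  "char_vec S = (\<chi> v. indicator S v)"

definition block_ones :: "'v::finite set \<Rightarrow> 'v set \<Rightarrow> real^'v^'v" where
  "block_ones S T = (\<chi> v w. char_vec S $ v * char_vec T $ w)"

definition gbls_tuple :: "'v::finite rel \<Rightarrow> (real^'v^'v) list" where
  "gbls_tuple G =
     adj_matrix G # [block_ones S T. S \<leftarrow> degree_classes G, T \<leftarrow> degree_classes G]"

text \<open>
  Only meaningful for graphs with equal degree functions: then both graphs have the same
  list of degree classes, so the two tuples differ only in the adjacency matrix.
\<close>

definition gbls_equiv :: "'v::finite rel \<Rightarrow> 'v rel \<Rightarrow> bool" where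
  "gbls_equiv G H \<longleftrightarrow>
     pencil_charpoly (gbls_tuple G) = pencil_charpoly (gbls_tuple H)"

end

theory Submission
  imports Defs "Jordan_Normal_Form.Char_Poly"
begin

text \<open>
  The weight which the pencil gives to a pair \<open>(v, w)\<close> depends only on the adjacency of \<open>v\<close> and
  \<open>w\<close> and on their degrees, and both are read off the color of \<open>(v, w)\<close> after one refinement.
  Splitting a walk at its last step shows inductively that the color after \<open>k + 1\<close> refinements
  determines the total weight of the walks of length \<open>k\<close> from \<open>v\<close> to \<open>w\<close>. Colors also detect
  the diagonal, so the two pencils have equal traces of powers, and by Newton's identities (valid
  in the polynomial ring, a domain of characteristic 0) equal characteristic polynomials.
\<close>

no_notation Matrix.vec_index (infixl "$" 100)

section \<open>Traces of powers determine the characteristic polynomial\<close>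

definition mat_trace :: "'a::comm_ring_1 mat \<Rightarrow> 'a" where
  "mat_trace A = (\<Sum>i<dim_row A. A $$ (i, i))"

lemma smult_sum_right: "Polynomial.smult c (sum f S) = (\<Sum>i\<in>S. Polynomial.smult c (f i))"
  by (induction S rule: infinite_finite_induct) (auto simp: smult_add_right)

text \<open>
  The generating function of the identities is \<open>tr (A\<^sup>m adj (x - A))\<close>, called \<open>u m\<close> in the proof:
  \<open>u 0\<close> is the derivative of the characteristic polynomial \<open>p\<close>, and
  \<open>x u m - u (m + 1) = tr (A\<^sup>m) p\<close>. Any large \<open>K\<close> is allowed since the summands eventually vanish,
  which avoids truncated subtraction in the summation bound.
\<close>

lemma Newton_identity:
  fixes A :: "'a::idom mat"
  assumes A: "A \<in> carrier_mat n n"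
  shows "\<exists>K0. \<forall>K\<ge>K0. \<forall>k. of_nat k * coeff (char_poly A) k =
    of_nat n * coeff (char_poly A) k +
    (\<Sum>j<K. mat_trace (A ^\<^sub>m Suc j) * coeff (char_poly A) (k + 1 + j))"
proof -
  define p where "p = char_poly A"
  define X where "X = char_poly_matrix A"
  define N where "N = adj_mat X"
  define s where "s m = mat_trace (A ^\<^sub>m m)" for m
  define u where "u m = (\<Sum>i<n. \<Sum>j<n. Polynomial.smult ((A ^\<^sub>m m) $$ (i, j)) (N $$ (j, i)))" for m
  have X: "X \<in> carrier_mat n n" using A by (simp add: X_def)
  note N = adj_mat[OF X, folded N_def]
  have dimP: "A ^\<^sub>m m \<in> carrier_mat n n" for m using A by simp
  \<comment> \<open>This is the entrywise form of \<open>(x - A) N = p I\<close>; multiplying it by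
    \<open>A ^\<^sub>m m\<close> on the left and taking the trace gives
    \<open>u_Suc\<close>.\<close>
  have XN: "[:0, 1:] * N $$ (j, i) - (\<Sum>l<n. Polynomial.smult (A $$ (j, l)) (N $$ (l, i))) =
      (if j = i then p else 0)" if "i < n" "j < n" for i j
  proof -
    have "(X * N) $$ (j, i) = (\<Sum>l<n. X $$ (j, l) * N $$ (l, i))"
      using that X N(1) by (simp add: scalar_prod_def atLeast0LessThan)
    also have "\<dots> = (\<Sum>l<n. (if l = j then [:0, 1:] * N $$ (l, i) else 0) - Polynomial.smult (A $$ (j, l)) (N $$ (l, i)))"
      using that A by (intro sum.cong) (auto simp: X_def char_poly_matrix_def algebra_simps)
    also have "\<dots> = [:0, 1:] * N $$ (j, i) - (\<Sum>l<n. Polynomial.smult (A $$ (j, l)) (N $$ (l, i)))"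
      using that by (simp add: sum_subtractf)
    finally have *: "(X * N) $$ (j, i) = \<dots>" .
    have "(X * N) $$ (j, i) = (if j = i then p else 0)"
      using that unfolding N(2) by (simp add: p_def char_poly_def X_def)
    with * show ?thesis by simp
  qed
  have u_Suc: "[:0, 1:] * u m - u (Suc m) = Polynomial.smult (s m) p" for m
  proof -
    let ?P = "A ^\<^sub>m m"
    have "u (Suc m) = (\<Sum>i<n. \<Sum>l<n. \<Sum>j<n. Polynomial.smult (?P $$ (i, j)) (Polynomial.smult (A $$ (j, l)) (N $$ (l, i))))"
      unfolding u_def using A dimP[of m]
      by (intro sum.cong refl)
        (auto simp: scalar_prod_def atLeast0LessThan Polynomial.smult_sum intro!: sum.cong)
    also have "\<dots> = (\<Sum>i<n. \<Sum>j<n. Polynomial.smult (?P $$ (i, j)) (\<Sum>l<n. Polynomial.smult (A $$ (j, l)) (N $$ (l, i))))"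
      unfolding smult_sum_right by (intro sum.cong[OF refl] sum.swap)
    finally have "[:0, 1:] * u m - u (Suc m) = (\<Sum>i<n. \<Sum>j<n. Polynomial.smult (?P $$ (i, j))
        ([:0, 1:] * N $$ (j, i) - (\<Sum>l<n. Polynomial.smult (A $$ (j, l)) (N $$ (l, i)))))"
      unfolding u_def by (simp add: sum_distrib_left Polynomial.smult_diff_right sum_subtractf)
    also have "\<dots> = (\<Sum>i<n. \<Sum>j<n. if j = i then Polynomial.smult (?P $$ (i, i)) p else 0)"
      by (intro sum.cong refl, subst XN) auto
    also have "\<dots> = Polynomial.smult (s m) p"
      using dimP[of m] A by (simp add: s_def mat_trace_def Polynomial.smult_sum)
    finally show ?thesis .
  qed
  have s0: "s 0 = of_nat n"
    using A by (simp add: s_def mat_trace_def)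
  have u0: "u 0 = pderiv p"
  proof -
    have "u 0 = (\<Sum>i<n. \<Sum>j<n. if j = i then N $$ (i, i) else 0)"
      unfolding u_def using A by (intro sum.cong refl) auto
    also have "\<dots> = (\<Sum>i<n. N $$ (i, i))" by simp
    \<comment> \<open>Diagonal cofactors of \<open>x - A\<close> are the characteristic polynomials
      of the principal minors, and these sum to the derivative of \<open>p\<close>.\<close>
    also have "\<dots> = (\<Sum>i<n. char_poly (mat_delete A i i))"
    proof (intro sum.cong refl)
      fix i assume i: "i \<in> {..<n}"
      have "mat_delete X i i = char_poly_matrix (mat_delete A i i)"
        using i A by (intro eq_matI) (auto simp: X_def char_poly_matrix_def mat_delete_def)
      then show "N $$ (i, i) = char_poly (mat_delete A i i)"
        using i X by (simp add: N_def adj_mat_def cofactor_def char_poly_def)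
    qed
    finally show ?thesis using pderiv_char_poly[OF A] by (simp add: p_def)
  qed
  \<comment> \<open>Each \<open>u m\<close> is a scalar combination of entries of \<open>N\<close>,
    so a bound on their degrees serves all \<open>m\<close> at once.\<close>
  define K0 where "K0 = Suc (\<Sum>i<n. \<Sum>j<n. degree (N $$ (i, j)))"
  have u_high: "coeff (u m) k = 0" if "k \<ge> K0" for m k
  proof -
    have "degree (N $$ (j, i)) < k" if "i < n" "j < n" for i j
    proof -
      have "degree (N $$ (j, i)) \<le> (\<Sum>i<n. degree (N $$ (j, i)))"
        using that by (intro member_le_sum) auto
      also have "\<dots> \<le> (\<Sum>j<n. \<Sum>i<n. degree (N $$ (j, i)))"
        using that by (intro member_le_sum[where f = "\<lambda>j. \<Sum>i<n. degree (N $$ (j, i))"]) auto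
      also have "\<dots> < k" using \<open>k \<ge> K0\<close> by (simp add: K0_def)
      finally show ?thesis .
    qed
    then show ?thesis by (simp add: u_def coeff_sum coeff_eq_0)
  qed
  have u_coeff: "coeff (u m) k = s m * coeff p (Suc k) + coeff (u (Suc m)) (Suc k)" for m k
    using arg_cong[OF u_Suc[of m], of "\<lambda>q. coeff q (Suc k)"] by (simp add: algebra_simps)
  have expand: "coeff (u m) k = (\<Sum>j<K. s (m + j) * coeff p (k + 1 + j)) + coeff (u (m + K)) (k + K)"
    for m k K
    by (induction K) (auto simp: u_coeff[of "m + _"])
  show ?thesis
  proof (intro exI[of _ K0] allI impI)
    fix K k assume K: "K \<ge> K0"
    \<comment> \<open>The factor x undoes the index shift of the derivative, which also covers
      \<open>k = 0\<close>.\<close>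
    have "of_nat k * coeff p k = coeff ([:0, 1:] * u 0) k"
      by (cases k) (auto simp: u0 coeff_pderiv)
    also have "\<dots> = coeff (u 1) k + of_nat n * coeff p k"
      using arg_cong[OF u_Suc[of 0], of "\<lambda>q. coeff q k"] s0
      by (simp add: algebra_simps)
    also have "coeff (u 1) k = (\<Sum>j<K. s (Suc j) * coeff p (k + 1 + j))"
      using expand[of 1 k K] u_high[of "k + K" "1 + K"] K by simp
    finally show "of_nat k * coeff (char_poly A) k = of_nat n * coeff (char_poly A) k +
      (\<Sum>j<K. mat_trace (A ^\<^sub>m Suc j) * coeff (char_poly A) (k + 1 + j))"
      by (simp add: p_def s_def add.commute)
  qed
qed

text \<open>Descending induction on the coefficient index, starting from the leading coefficient 1:
  for \<open>k < n\<close> Newton's identity expresses \<open>k - n\<close> times the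
  \<open>k\<close>-th coefficient by traces and higher coefficients, and \<open>k - n\<close> can be
  cancelled in a domain of characteristic 0.\<close>

lemma char_poly_eq_if_traces_eq:
  fixes A B :: "'a::{idom, ring_char_0} mat"
  assumes A: "A \<in> carrier_mat n n" and B: "B \<in> carrier_mat n n"
    and tr: "\<And>k. mat_trace (A ^\<^sub>m k) = mat_trace (B ^\<^sub>m k)"
  shows "char_poly A = char_poly B"
proof -
  obtain KA where KA: "\<And>K k. K \<ge> KA \<Longrightarrow> of_nat k * coeff (char_poly A) k =
    of_nat n * coeff (char_poly A) k +
    (\<Sum>j<K. mat_trace (A ^\<^sub>m Suc j) * coeff (char_poly A) (k + 1 + j))"
    using Newton_identity[OF A] by blast
  obtain KB where KB: "\<And>K k. K \<ge> KB \<Longrightarrow> of_nat k * coeff (char_poly B) k =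
    of_nat n * coeff (char_poly B) k +
    (\<Sum>j<K. mat_trace (B ^\<^sub>m Suc j) * coeff (char_poly B) (k + 1 + j))"
    using Newton_identity[OF B] by blast
  note dA = degree_monic_char_poly[OF A] and dB = degree_monic_char_poly[OF B]
  have low: "coeff (char_poly A) (n - d) = coeff (char_poly B) (n - d)" if "d \<le> n" for d
    using that
  proof (induction d rule: less_induct)
    case (less d)
    \<comment> \<open>\<open>?K\<close> is a truncation length allowed for both matrices.\<close>
    let ?k = "n - d" and ?K = "max KA KB"
    let ?S = "\<Sum>j<?K. mat_trace (A ^\<^sub>m Suc j) * coeff (char_poly A) (?k + 1 + j)"
    show ?case
    proof (cases "d = 0")
      case True
      then show ?thesis using dA dB by simp
    next
      case False
      have high: "coeff (char_poly A) l = coeff (char_poly B) l" if "l > ?k" for l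
      proof (cases "l \<le> n")
        case True
        then show ?thesis using less.IH[of "n - l"] less.prems that by auto
      next
        case False
        then show ?thesis using dA dB by (simp add: coeff_eq_0)
      qed
      have "(of_nat ?k - of_nat n) * coeff (char_poly A) ?k = ?S"
        using KA[of ?K ?k] by (simp only: left_diff_distrib) simp
      moreover have "?S = (\<Sum>j<?K. mat_trace (B ^\<^sub>m Suc j) * coeff (char_poly B) (?k + 1 + j))"
        by (intro sum.cong refl arg_cong2[of _ _ _ _ "(*)"] tr high) simp
      moreover have "(of_nat ?k - of_nat n) * coeff (char_poly B) ?k = \<dots>"
        using KB[of ?K ?k] by (simp only: left_diff_distrib) simp
      moreover have "(of_nat ?k - of_nat n :: 'a) \<noteq> 0"
        using False less.prems by (simp add: of_nat_diff)
      ultimately show ?thesis by (metis mult_left_cancel)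
    qed
  qed
  show ?thesis
  proof (rule poly_eqI)
    fix k show "coeff (char_poly A) k = coeff (char_poly B) k"
    proof (cases "k \<le> n")
      case True
      then show ?thesis using low[of "n - k"] by simp
    next
      case False
      then show ?thesis using dA dB by (simp add: coeff_eq_0)
    qed
  qed
qed


section \<open>Matrices indexed by a finite type\<close>

text \<open>Conjugation by \<open>f\<close> is a sign-preserving bijection between the permutations
  of the two index sets, so the Leibniz sums agree term by term.\<close>

lemma det_reindex:
  fixes M :: "'a::comm_ring_1^'v::finite^'v"
  assumes f: "bij_betw f {0..<n} (UNIV :: 'v set)"
  shows "Determinants.det M = Determinant.det (Matrix.mat n n (\<lambda>(i, j). M $ f i $ f j))"
proof -
  let ?I = "{0..<n}"
  let ?\<sigma> = "map_permutation ?I f"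
  have inj: "inj_on f ?I" using f by (simp add: bij_betw_def)
  have bij: "bij_betw ?\<sigma> {p. p permutes ?I} {p. p permutes (UNIV :: 'v set)}"
  proof -
    have "?\<sigma> = (\<lambda>p x. if x \<in> UNIV then f (p (inv_into ?I f x)) else x)"
      using f by (auto simp: map_permutation_def restrict_id_def bij_betw_def fun_eq_iff)
    then show ?thesis using bij_betw_permutations[OF f] by simp
  qed
  have "Determinants.det M = (\<Sum>p | p permutes ?I. of_int (sign (?\<sigma> p)) * (\<Prod>v\<in>UNIV. M $ v $ ?\<sigma> p v))"
    unfolding Determinants.det_def by (rule sum.reindex_bij_betw[OF bij, symmetric])
  also have "\<dots> = (\<Sum>p | p permutes ?I. signof p * (\<Prod>i = 0..<n. M $ f i $ f (p i)))"
  proof (intro sum.cong refl arg_cong2[of _ _ _ _ "(*)"])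
    fix p assume "p \<in> {p. p permutes ?I}"
    then have p: "p permutes ?I" by simp
    show "of_int (sign (?\<sigma> p)) = (signof p :: 'a)"
      using sign_map_permutation[OF inj p] by (simp add: sign_def)
    have "(\<Prod>v\<in>UNIV. M $ v $ ?\<sigma> p v) = (\<Prod>i\<in>?I. M $ f i $ ?\<sigma> p (f i))"
      by (rule prod.reindex_bij_betw[OF f, symmetric])
    also have "\<dots> = (\<Prod>i = 0..<n. M $ f i $ f (p i))"
      using inj by (intro prod.cong refl) (simp add: map_permutation_apply)
    finally show "(\<Prod>v\<in>UNIV. M $ v $ ?\<sigma> p v) = (\<Prod>i = 0..<n. M $ f i $ f (p i))" .
  qed
  also have "\<dots> = Determinant.det (Matrix.mat n n (\<lambda>(i, j). M $ f i $ f j))"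
  proof -
    have "p i < n" if "p permutes ?I" "i < n" for p i
      using permutes_in_image[OF that(1), of i] that(2) by simp
    then show ?thesis
      by (subst det_def'[of _ n]) (auto intro!: sum.cong arg_cong2[of _ _ _ _ "(*)"] prod.cong)
  qed
  finally show ?thesis .
qed

lemma poly_char_poly:
  assumes A: "A \<in> carrier_mat n n"
  shows "poly (char_poly A) x = Determinant.det (x \<cdot>\<^sub>m 1\<^sub>m n - A)"
  unfolding char_poly_def
  by (rule poly_det_cong[of _ n]) (use A in \<open>auto simp: char_poly_matrix_def\<close>)

text \<open>In the application \<open>x\<close> is the variable \<open>mvar 0\<close> of the
  coefficient ring itself, so the determinant of the pencil is a value of a univariate
  characteristic polynomial over that ring.\<close>

lemma det_pencil_char_poly:
  fixes L :: "'a::comm_ring_1^'v::finite^'v"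
  assumes f: "bij_betw f {0..<n} (UNIV :: 'v set)"
  shows "Determinants.det (Finite_Cartesian_Product.mat x - L) = poly (char_poly (Matrix.mat n n (\<lambda>(i, j). L $ f i $ f j))) x"
proof -
  have "f i = f j \<longleftrightarrow> i = j" if "i < n" "j < n" for i j
    using f that by (auto simp: bij_betw_def inj_on_def)
  then have "Matrix.mat n n (\<lambda>(i, j). (Finite_Cartesian_Product.mat x - L) $ f i $ f j) =
    x \<cdot>\<^sub>m 1\<^sub>m n - Matrix.mat n n (\<lambda>(i, j). L $ f i $ f j)"
    by (intro eq_matI) (auto simp: Finite_Cartesian_Product.mat_def)
  then show ?thesis
    unfolding det_reindex[OF f] by (subst poly_char_poly[of _ n]) auto
qed

text \<open>The entries of the powers of \<open>L\<close>. Recursion on the last step matches a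
  refinement round, which splits \<open>(v, w)\<close> into \<open>(v, m)\<close> and
  \<open>(m, w)\<close>.\<close>

primrec walk_weight :: "'a::comm_ring_1^'v::finite^'v \<Rightarrow> nat \<Rightarrow> 'v \<Rightarrow> 'v \<Rightarrow> 'a" where
  "walk_weight L 0 v w = (if v = w then 1 else 0)"
| "walk_weight L (Suc k) v w = (\<Sum>m\<in>UNIV. walk_weight L k v m * L $ m $ w)"

lemma pow_mat_walk_weight:
  fixes L :: "'a::comm_ring_1^'v::finite^'v"
  assumes f: "bij_betw f {0..<n} (UNIV :: 'v set)" and "i < n" "j < n"
  shows "(Matrix.mat n n (\<lambda>(i, j). L $ f i $ f j) ^\<^sub>m k) $$ (i, j) = walk_weight L k (f i) (f j)"
  using assms(2,3)
proof (induction k arbitrary: j)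
  case 0
  then show ?case using f by (auto simp: bij_betw_def inj_on_def)
next
  case (Suc k)
  let ?A = "Matrix.mat n n (\<lambda>(i, j). L $ f i $ f j)"
  have "?A ^\<^sub>m k \<in> carrier_mat n n" by simp
  then have "(?A ^\<^sub>m Suc k) $$ (i, j) = (\<Sum>m = 0..<n. (?A ^\<^sub>m k) $$ (i, m) * ?A $$ (m, j))"
    using Suc.prems by (simp add: scalar_prod_def)
  also have "\<dots> = (\<Sum>m = 0..<n. walk_weight L k (f i) (f m) * L $ f m $ f j)"
    using Suc by (intro sum.cong) auto
  also have "\<dots> = walk_weight L (Suc k) (f i) (f j)"
    by (simp add: sum.reindex_bij_betw[OF f, of "\<lambda>m. walk_weight L k (f i) m * L $ m $ f j"])
  finally show ?case .
qed

text \<open>The closed walk sums are the traces of the powers.\<close>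

lemma det_pencil_eq_if_closed_walks_eq:
  fixes L M :: "'a::{idom, ring_char_0}^'v::finite^'v"
  assumes "\<And>k. (\<Sum>v\<in>UNIV. walk_weight L k v v) = (\<Sum>v\<in>UNIV. walk_weight M k v v)"
  shows "Determinants.det (Finite_Cartesian_Product.mat x - L) = Determinants.det (Finite_Cartesian_Product.mat x - M)"
proof -
  obtain f where f: "bij_betw f {0..<CARD('v)} (UNIV :: 'v set)"
    using ex_bij_betw_nat_finite[of "UNIV :: 'v set"] by auto
  have tr: "mat_trace (Matrix.mat CARD('v) CARD('v) (\<lambda>(i, j). P $ f i $ f j) ^\<^sub>m k) =
    (\<Sum>v\<in>UNIV. walk_weight P k v v)" for P :: "'a^'v^'v" and k
  proof -
    have "mat_trace (Matrix.mat CARD('v) CARD('v) (\<lambda>(i, j). P $ f i $ f j) ^\<^sub>m k) =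
      (\<Sum>i = 0..<CARD('v). walk_weight P k (f i) (f i))"
      unfolding mat_trace_def
      by (intro sum.cong) (auto simp: pow_mat_walk_weight[OF f])
    also have "\<dots> = (\<Sum>v\<in>UNIV. walk_weight P k v v)"
      by (rule sum.reindex_bij_betw[OF f])
    finally show ?thesis .
  qed
  show ?thesis
    unfolding det_pencil_char_poly[OF f]
    by (subst char_poly_eq_if_traces_eq[of _ "CARD('v)"]) (auto simp: tr assms)
qed


section \<open>Weighted walks and Weisfeiler--Leman colors\<close>

text \<open>Equal images yield a matching of \<open>M\<close> with \<open>N\<close> along which
  \<open>f\<close> and \<open>g\<close> agree, hence also \<open>F\<close> and
  \<open>G\<close>.\<close>

lemma image_mset_eq_transfer:
  assumes "image_mset f M = image_mset g N"
    and "\<And>x y. x \<in># M \<Longrightarrow> y \<in># N \<Longrightarrow> f x = g y \<Longrightarrow> F x = G y"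
  shows "image_mset F M = image_mset G N"
proof -
  have "rel_mset (\<lambda>x y. f x = g y) M N"
    using assms(1) by (simp flip: multiset.rel_eq add: multiset.rel_map)
  then have "rel_mset (\<lambda>x y. F x = G y) M N"
    by (rule multiset.rel_mono_strong) (use assms(2) in auto)
  then show ?thesis
    by (simp flip: multiset.rel_eq add: multiset.rel_map)
qed

lemma sum_eq_if_image_mset_eq:
  assumes "image_mset f (mset_set S) = image_mset g (mset_set T)"
    and "finite S" "finite T"
    and "\<And>x y. x \<in> S \<Longrightarrow> y \<in> T \<Longrightarrow> f x = g y \<Longrightarrow> F x = G y"
  shows "sum F S = sum G T"
proof -
  have "image_mset F (mset_set S) = image_mset G (mset_set T)"
    using assms by (intro image_mset_eq_transfer[OF assms(1)]) auto
  then show ?thesis by (simp add: sum_unfold_sum_mset)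
qed

text \<open>Every refined color contains its predecessor, so equality descends to the atomic
  types.\<close>

lemma wl_coloring_eqD:
  assumes "wl_coloring A r [v, w] = wl_coloring B r [v', w']"
  shows "v = w \<longleftrightarrow> v' = w'" "A $ v $ w = B $ v' $ w'"
proof -
  have "wl_coloring A 0 [v, w] = wl_coloring B 0 [v', w']"
    using assms by (induction r) auto
  then show "v = w \<longleftrightarrow> v' = w'" "A $ v $ w = B $ v' $ w'"
    by (auto simp: atomic_type_def split: if_splits)
qed

lemma wl_coloring_Suc_eqD:
  assumes "wl_coloring A (Suc r) [v, w] = wl_coloring B (Suc r) [v', w']"
  shows "image_mset (\<lambda>m. (atomic_type A [v, w, m], wl_coloring A r [v, m], wl_coloring A r [m, w]))
      (mset_set UNIV) =
    image_mset (\<lambda>m. (atomic_type B [v', w', m], wl_coloring B r [v', m], wl_coloring B r [m, w']))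
      (mset_set UNIV)"
proof -
  \<comment> \<open>The last entry is replaced first, giving \<open>[v, m]\<close> before
    \<open>[m, w]\<close>.\<close>
  have "rev [0..<2] = [1, 0 :: nat]" by (simp add: upt_rec numeral_2_eq_2)
  then show ?thesis
    using assms by (auto simp: numeral_2_eq_2 elim!: image_mset_eq_transfer)
qed

lemma vdeg_eq_sum:
  "vdeg G (v :: 'v::finite) = (\<Sum>m\<in>UNIV. if (v, m) \<in> G then 1 else 0)"
  by (simp add: vdeg_def sum.If_cases)

text \<open>The atomic type of \<open>[v, w, m]\<close> shows whether \<open>m\<close> is a neighbor
  of \<open>v\<close> and of \<open>w\<close>; one refinement collects this over all
  \<open>m\<close>.\<close>

lemma vdeg_eq_if_wl_coloring_eq:
  fixes G :: "'v::finite rel" and H :: "'w::finite rel"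
  assumes "wl_coloring (adj_matrix G) (Suc r) [v, w] = wl_coloring (adj_matrix H) (Suc r) [v', w']"
  shows "vdeg G v = vdeg H v'" "vdeg G w = vdeg H w'"
proof -
  note eq = wl_coloring_Suc_eqD[OF assms]
  show "vdeg G v = vdeg H v'"
    unfolding vdeg_eq_sum by (rule sum_eq_if_image_mset_eq[OF eq])
      (auto simp: atomic_type_def adj_matrix_def split: if_splits)
  show "vdeg G w = vdeg H w'"
    unfolding vdeg_eq_sum by (rule sum_eq_if_image_mset_eq[OF eq])
      (auto simp: atomic_type_def adj_matrix_def split: if_splits)
qed

text \<open>Each step of a walk uses up one refinement; the additional one keeps the degrees
  visible. In the induction step the color of \<open>(v, m)\<close> determines the weight of the
  shorter walks, and that of \<open>(m, w)\<close> the adjacency and degrees entering the last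
  step.\<close>

lemma walk_weight_eq_if_wl_coloring_eq:
  fixes G H :: "'v::finite rel"
  assumes L: "\<And>v w. L $ v $ w = K (adj_matrix G $ v $ w) (vdeg G v) (vdeg G w)"
    and M: "\<And>v w. M $ v $ w = K (adj_matrix H $ v $ w) (vdeg H v) (vdeg H w)"
    and "wl_coloring (adj_matrix G) (Suc k) [v, w] = wl_coloring (adj_matrix H) (Suc k) [v', w']"
  shows "walk_weight L k v w = walk_weight M k v' w'"
  using assms(3)
proof (induction k arbitrary: v w v' w')
  case 0
  have "v = w \<longleftrightarrow> v' = w'"
    using 0 by (rule wl_coloring_eqD)
  then show ?case by simp
next
  case (Suc k)
  show ?case
    unfolding walk_weight.simps
  proof (rule sum_eq_if_image_mset_eq[OF wl_coloring_Suc_eqD[OF Suc.prems]])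
    fix m m'
    assume "(atomic_type (adj_matrix G) [v, w, m], wl_coloring (adj_matrix G) (Suc k) [v, m],
        wl_coloring (adj_matrix G) (Suc k) [m, w]) =
      (atomic_type (adj_matrix H) [v', w', m'], wl_coloring (adj_matrix H) (Suc k) [v', m'],
        wl_coloring (adj_matrix H) (Suc k) [m', w'])"
    then have c: "wl_coloring (adj_matrix G) (Suc k) [v, m] = wl_coloring (adj_matrix H) (Suc k) [v', m']"
        "wl_coloring (adj_matrix G) (Suc k) [m, w] = wl_coloring (adj_matrix H) (Suc k) [m', w']"
      by auto
    have "adj_matrix G $ m $ w = adj_matrix H $ m' $ w'"
      using c(2) by (rule wl_coloring_eqD)
    then show "walk_weight L k v m * L $ m $ w = walk_weight M k v' m' * M $ m' $ w'"
      using Suc.IH[OF c(1)] vdeg_eq_if_wl_coloring_eq[OF c(2)] by (simp add: L M)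
  qed auto
qed

lemma closed_walk_weight_eq_if_wl_equiv:
  fixes G H :: "'v::finite rel"
  assumes L: "\<And>v w. L $ v $ w = K (adj_matrix G $ v $ w) (vdeg G v) (vdeg G w)"
    and M: "\<And>v w. M $ v $ w = K (adj_matrix H $ v $ w) (vdeg H v) (vdeg H w)"
    and "wl_equiv 2 G H"
  shows "(\<Sum>v\<in>UNIV. walk_weight L k v v) = (\<Sum>v\<in>UNIV. walk_weight M k v v)"
proof -
  let ?S = "{xs :: 'v list. length xs = 2}"
  \<comment> \<open>The multiset of colors ranges over all pairs, so closed walk weights are
    extended by 0 off the diagonal, which colors detect.\<close>
  define diag where "diag P xs = (if xs ! 0 = xs ! 1 then walk_weight P k (xs ! 0) (xs ! 0) else 0)"
    for P :: "'a^'v^'v" and xs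
  have fin: "finite ?S"
    using finite_lists_length_eq[of "UNIV :: 'v set" 2] by simp
  have diag: "sum (diag P) ?S = (\<Sum>v\<in>UNIV. walk_weight P k v v)" for P
  proof -
    have "sum (diag P) ?S = sum (diag P) ((\<lambda>v. [v, v]) ` UNIV)"
      by (rule sum.mono_neutral_right)
        (use fin in \<open>auto simp: diag_def numeral_2_eq_2 length_Suc_conv\<close>)
    also have "\<dots> = (\<Sum>v\<in>UNIV. diag P [v, v])"
      by (simp add: sum.reindex inj_on_def)
    finally show ?thesis by (simp add: diag_def)
  qed
  have "wl_multiset (adj_matrix G) 2 (Suc k) = wl_multiset (adj_matrix H) 2 (Suc k)"
    \<comment> \<open>The exponent \<open>Suc (Suc k)\<close> belongs to the coloring after
      \<open>k + 1\<close> refinements.\<close>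
    using arg_cong[OF assms(3)[unfolded wl_equiv_def], of "\<lambda>s. fps_nth s (Suc (Suc k))"]
    by (simp add: wl_series_def)
  then have "sum (diag L) ?S = sum (diag M) ?S"
    unfolding wl_multiset_def
  proof (rule sum_eq_if_image_mset_eq[OF _ fin fin])
    fix xs ys
    assume "xs \<in> ?S" "ys \<in> ?S"
    then obtain v w v' w' where xy: "xs = [v, w]" "ys = [v', w']"
      by (auto simp: numeral_2_eq_2 length_Suc_conv)
    assume "wl_coloring (adj_matrix G) (Suc k) xs = wl_coloring (adj_matrix H) (Suc k) ys"
    note c = this[unfolded xy]
    have "v = w \<longleftrightarrow> v' = w'"
      using c by (rule wl_coloring_eqD)
    then show "diag L xs = diag M ys"
      using walk_weight_eq_if_wl_coloring_eq[OF L M c] by (auto simp: diag_def xy)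
  qed
  then show ?thesis by (simp add: diag)
qed


section \<open>The pencil as a function of adjacency and degrees\<close>

text \<open>This is the common function \<open>K\<close> of the walk lemmas. The coefficient list
  follows the order of \<open>gbls_tuple\<close>, so that the variables correspond.\<close>

definition degree_weight :: "nat list \<Rightarrow> real \<Rightarrow> nat \<Rightarrow> nat \<Rightarrow> real mpoly" where
  "degree_weight ds a d e =
     (let cs = a # [indicator {x} d * indicator {y} e. x \<leftarrow> ds, y \<leftarrow> ds]
      in \<Sum>i<length cs. mvar (Suc i) * mconst (cs ! i))"

lemma lin_pencil_gbls_tuple:
  fixes G :: "'v::finite rel"
  shows "lin_pencil (gbls_tuple G) $ v $ w =
    degree_weight (sorted_list_of_set (range (vdeg G))) (adj_matrix G $ v $ w) (vdeg G v) (vdeg G w)"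
proof -
  let ?ds = "sorted_list_of_set (range (vdeg G))"
  have "map (\<lambda>A. A $ v $ w) (gbls_tuple G) =
    adj_matrix G $ v $ w # [indicator {x} (vdeg G v) * indicator {y} (vdeg G w). x \<leftarrow> ?ds, y \<leftarrow> ?ds]"
    by (simp add: gbls_tuple_def degree_classes_def block_ones_def char_vec_def map_concat o_def
        indicator_def)
  moreover have "lin_pencil As $ v $ w =
      (\<Sum>i<length (map (\<lambda>A. A $ v $ w) As). mvar (Suc i) * mconst (map (\<lambda>A. A $ v $ w) As ! i))"
    for As :: "(real^'v^'v) list"
    by (simp add: lin_pencil_def)
  ultimately show ?thesis by (simp only: degree_weight_def Let_def)
qed

theorem theorem1p2:
  fixes G H :: "'v::finite rel"
  assumes "simple_graph G" and "simple_graph H"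
    and "\<forall>v. vdeg G v = vdeg H v"
    and "wl_equiv 2 G H"
  shows "gbls_equiv G H"
proof -
  \<comment> \<open>Equal degree functions give both pencils the same list of degrees, so a single
    \<open>degree_weight\<close> describes both.\<close>
  have "vdeg G = vdeg H" using assms(3) by auto
  then show ?thesis
    unfolding gbls_equiv_def pencil_charpoly_def
    by (intro det_pencil_eq_if_closed_walks_eq closed_walk_weight_eq_if_wl_equiv[OF _ _ assms(4)])
      (simp_all add: lin_pencil_gbls_tuple)
qed

end
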